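(* Let $d\ge2$ and let $A=[A(i_1,\ldots,i_d)]$ be a tensor. Suppose there is a tensor $X$ in tensor train format with ranks $r_1,\ldots,r_{d-1}$ such that $|A-X|\le E_C$ and $\|A-X\|\le E_F$. Choose successively for $k=d-1,d-2,\ldots,1$ $$[\mathcal I^{\leq k},\mathcal I^{>k}]=\mathrm{maxvol}\,\big[A(i_{\leq k},\,i_{k+1}\mathcal I^{>k+1})\big],$$ with $r_k$ rows and $r_k$ columns, and suppose that each $A_k=[A(\mathcal I^{\leq k},\mathcal I^{>k})]$ is nonsingular. Let $\tilde A$ be the tensor train cross interpolation of $A$ on these sets and $r=\max_k r_k$. Then $$|A-\tilde A|\le\frac{r^{d-1}-1}{r-1}\,(r+1)\,E_F\qquad\text{and}\qquad |A-\tilde A|\le\frac{r^{d-1}-1}{r-1}\,(r+1)^2\,E_C ,$$ where for $r=1$ the fraction is read as $d-1$.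
   Context: Tensors are real or complex arrays with indices $i_k\in\{1,\ldots,n_k\}$, $k=1,\ldots,d$. $|A|=\max|A(i_1,\ldots,i_d)|$ (Chebyshev norm) and $\|A\|=\big(\sum|A(i_1,\ldots,i_d)|^2\big)^{1/2}$ (Frobenius norm). Multi-indices: $i_{\leq k}=(i_1,\ldots,i_k)$, $i_{>k}=(i_{k+1},\ldots,i_d)$. $X$ is in tensor train (TT) format with ranks $r_1,\ldots,r_{d-1}$ (and $r_0=r_d=1$) if $X(i_1,\ldots,i_d)=\sum_{s_1,\ldots,s_{d-1}}\prod_{k=1}^d X^{(k)}(s_{k-1},i_k,s_k)$, with $s_k$ running over $1,\ldots,r_k$. Interpolation sets: $\mathcal I^{\leq k}=\{\mathcal I^{\leq k}_1,\ldots,\mathcal I^{\leq k}_{r_k}\}$ is a set of $r_k$ distinct left multi-indices $i_{\leq k}$ and $\mathcal I^{>k}=\{\mathcal I^{>k}_1,\ldots,\mathcal I^{>k}_{r_k}\}$ a set of $r_k$ distinct right multi-indices $i_{>k}$; $\mathcal I^{>d}$ is empty (no index restriction). $A_k=[A(\mathcal I^{\leq k}_{s},\mathcal I^{>k}_{t})]_{s,t=1}^{r_k}$ and $B^{[k]}=A_k^{-1}$. $[A(i_{\leq k},i_{k+1}\mathcal I^{>k+1})]$ is the matrix whose rows are indexed by all $i_{\leq k}$ and whose columns are indexed by all pairs $(i_{k+1},i_{>k+1})$ with $i_{k+1}\in\{1,\ldots,n_{k+1}\}$ arbitrary and $i_{>k+1}\in\mathcal I^{>k+1}$ (for $k=d-1$: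 columns indexed by $i_d$); thus it is a submatrix of the $k$-th unfolding of $A$, and elements of $\mathcal I^{>k}$ are of the form $(i_{k+1},i_{>k+1})$ with $i_{>k+1}\in\mathcal I^{>k+1}$. For a matrix $M$ and a prescribed size $r$, $[\mathcal I,\mathcal J]=\mathrm{maxvol}\,M$ means that $\mathcal I$ is a set of $r$ rows and $\mathcal J$ a set of $r$ columns for which $|\det M(\mathcal I,\mathcal J)|$ is maximal over all $r\times r$ submatrices of $M$. The tensor train cross interpolation on these sets is $$\tilde A(i_1,\ldots,i_d)=\sum_{s_1,\ldots,s_{d-1}}\sum_{t_1,\ldots,t_{d-1}}A(i_1,\mathcal I^{>1}_{t_1})\prod_{k=1}^{d-1}B^{[k]}_{t_k,s_k}\,A(\mathcal I^{\leq k}_{s_k},i_{k+1},\mathcal I^{>k+1}_{t_{k+1}}),$$ where $s_k,t_k$ run over $1,\ldots,r_k$ and for $k=d-1$ the last factor is $A(\mathcal I^{\leq d-1}_{s_{d-1}},i_d)$. *)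

theory Defs
  imports "Jordan_Normal_Form.Determinant" "Jordan_Normal_Form.Gauss_Jordan_Elimination"
    "HOL-Library.FuncSet"
begin

text \<open>
  A tensor of order \<open>d = length ns\<close> with mode sizes \<open>ns\<close> is a function on multi-indices, which are
  lists of numbers; only its values on \<open>multi_indices ns\<close> matter. Mode indices and rank indices
  start at 0, as for the type \<open>mat\<close>, so that \<open>i ! k\<close> and \<open>ns ! k\<close> belong to mode \<open>k + 1\<close>. Left and
  right multi-indices for the cut after mode \<open>k\<close> are the elements of \<open>multi_indices (take k ns)\<close>
  and \<open>multi_indices (drop k ns)\<close>, and the pair of both is the concatenation.

  The entries are taken in a field of class \<open>real_normed_field\<close>; \<open>real\<close> and \<open>complex\<close> are
  instances.
\<close>

definition multi_indices :: "nat list \<Rightarrow> nat list set" where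
  "multi_indices ns = {i. list_all2 (<) i ns}"

definition chebyshev_norm :: "nat list \<Rightarrow> (nat list \<Rightarrow> 'a::real_normed_field) \<Rightarrow> real" where
  "chebyshev_norm ns A = Max ((\<lambda>i. norm (A i)) ` multi_indices ns)"

definition frobenius_norm :: "nat list \<Rightarrow> (nat list \<Rightarrow> 'a::real_normed_field) \<Rightarrow> real" where
  "frobenius_norm ns A = sqrt (\<Sum>i\<in>multi_indices ns. (norm (A i))\<^sup>2)"

text \<open>
  The core \<open>G k\<close> belongs to mode \<open>k + 1\<close>. The sum runs over all \<open>s\<^sub>0, \<dots>, s\<^sub>d\<close>; the boundary
  conditions \<open>r 0 = 1\<close> and \<open>r d = 1\<close> fix \<open>s\<^sub>0\<close> and \<open>s\<^sub>d\<close>.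
\<close>

definition is_tensor_train ::
    "nat list \<Rightarrow> (nat \<Rightarrow> nat) \<Rightarrow> (nat list \<Rightarrow> 'a::real_normed_field) \<Rightarrow> bool" where
  "is_tensor_train ns r X \<longleftrightarrow> r 0 = 1 \<and> r (length ns) = 1 \<and>
     (\<exists>G :: nat \<Rightarrow> nat \<Rightarrow> nat \<Rightarrow> nat \<Rightarrow> 'a. \<forall>i\<in>multi_indices ns.
        X i = (\<Sum>s\<in>(\<Pi>\<^sub>E k\<in>{..length ns}. {..<r k}).
                 \<Prod>k<length ns. G k (s k) (i ! k) (s (Suc k))))"

text \<open>
  Matrices whose rows and columns are labelled by arbitrary objects are functions of two arguments.
  A set of \<open>r\<close> rows (columns) is a duplicate-free list of labels; the enumeration only affects
  the sign of the determinant.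
\<close>

definition selection :: "'b set \<Rightarrow> nat \<Rightarrow> 'b list \<Rightarrow> bool" where
  "selection P r I \<longleftrightarrow> distinct I \<and> set I \<subseteq> P \<and> length I = r"

definition labelled_submat :: "('b \<Rightarrow> 'c \<Rightarrow> 'a) \<Rightarrow> 'b list \<Rightarrow> 'c list \<Rightarrow> 'a mat" where
  "labelled_submat M I J = mat (length I) (length J) (\<lambda>(s, t). M (I ! s) (J ! t))"

definition is_maxvol :: "('b \<Rightarrow> 'c \<Rightarrow> 'a::real_normed_field) \<Rightarrow> 'b set \<Rightarrow> 'c set \<Rightarrow> nat \<Rightarrow>
    'b list \<Rightarrow> 'c list \<Rightarrow> bool" where
  "is_maxvol M P Q r I J \<longleftrightarrow> selection P r I \<and> selection Q r J \<and>
     (\<forall>I' J'. selection P r I' \<longrightarrow> selection Q r J' \<longrightarrow>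
        norm (det (labelled_submat M I' J')) \<le> norm (det (labelled_submat M I J)))"

definition unfolding_entry :: "(nat list \<Rightarrow> 'a) \<Rightarrow> nat list \<Rightarrow> nat list \<Rightarrow> 'a" where
  "unfolding_entry A p q = A (p @ q)"

definition interp_mat :: "(nat list \<Rightarrow> 'a) \<Rightarrow> (nat \<Rightarrow> nat list list) \<Rightarrow> (nat \<Rightarrow> nat list list) \<Rightarrow>
    nat \<Rightarrow> 'a mat" where
  "interp_mat A L R k = labelled_submat (unfolding_entry A) (L k) (R k)"

text \<open>
  \<open>L k\<close> and \<open>R k\<close> enumerate the left and right interpolation sets. The absence of a restriction
  behind the last mode is expressed by \<open>R d = [[]]\<close>, so that for \<open>k = d - 1\<close> the column labels
  below are the one-element lists \<open>[i]\<close>.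
\<close>

definition extended_columns :: "nat list \<Rightarrow> (nat \<Rightarrow> nat list list) \<Rightarrow> nat \<Rightarrow> nat list set" where
  "extended_columns ns R k = {i # q | i q. i < ns ! k \<and> q \<in> set (R (Suc k))}"

text \<open>
  The library function \<open>mat_inverse\<close> returns an option, which is \<open>Some\<close> for invertible matrices.
  With \<open>r d = 1\<close> and \<open>R d = [[]]\<close>, the index \<open>t d\<close> is 0 and contributes the empty list
  to the last factor.
\<close>

definition tt_cross :: "nat \<Rightarrow> (nat \<Rightarrow> nat) \<Rightarrow> (nat list \<Rightarrow> 'a::real_normed_field) \<Rightarrow>
    (nat \<Rightarrow> nat list list) \<Rightarrow> (nat \<Rightarrow> nat list list) \<Rightarrow> nat list \<Rightarrow> 'a" where
  "tt_cross d r A L R i =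
     (\<Sum>s\<in>(\<Pi>\<^sub>E k\<in>{1..<d}. {..<r k}). \<Sum>t\<in>(\<Pi>\<^sub>E k\<in>{1..d}. {..<r k}).
        A (i ! 0 # R 1 ! t 1) *
        (\<Prod>k=1..<d. the (mat_inverse (interp_mat A L R k)) $$ (t k, s k) *
                     A (L k ! s k @ i ! k # R (Suc k) ! t (Suc k))))"

end

theory Submission
  imports Defs "HOL-Analysis.L2_Norm"
begin

text \<open>
  Error of one matrix cross: for a row \<open>i\<close> and a column \<open>j\<close>, the bordered submatrix \<open>H\<close> of \<open>A\<close>
  satisfies \<open>det H = det A\<^sub>k \<cdot> err i j\<close>, and by maximality of the volume no cofactor of \<open>H\<close> exceeds
  \<open>det A\<^sub>k\<close> in modulus. The corresponding submatrix of \<open>X\<close> has rank at most \<open>r\<close>, hence annihilates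
  some \<open>v \<noteq> 0\<close>, so that \<open>det H \<cdot> v = adj H \<cdot> (A - X) \<cdot> v\<close>. Reading off the largest entry of \<open>v\<close>
  bounds \<open>err i j\<close> by the sum of the moduli of the \<open>(r + 1)\<^sup>2\<close> entries of \<open>A - X\<close> on this submatrix,
  and the two bounds follow from Cauchy-Schwarz and from estimating each entry. No singular values
  are needed, so the argument works over any normed field.

  Error of the train: the interpolation coefficients of a maximal-volume cross are bounded by 1,
  so passing one more mode gives \<open>e (k + 1) \<le> \<delta> + r k * e k\<close> with \<open>e 1 = 0\<close>.
\<close>

section \<open>Cross approximation on a submatrix of maximal volume\<close>

lemma labelled_submat_carrier:
  "length I = m \<Longrightarrow> length J = n \<Longrightarrow> labelled_submat M I J \<in> carrier_mat m n"
  by (simp add: labelled_submat_def)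

lemma index_labelled_submat [simp]:
  "s < length I \<Longrightarrow> t < length J \<Longrightarrow> labelled_submat M I J $$ (s, t) = M (I ! s) (J ! t)"
  by (simp add: labelled_submat_def)

lemma dim_labelled_submat [simp]:
  "dim_row (labelled_submat M I J) = length I" "dim_col (labelled_submat M I J) = length J"
  by (simp_all add: labelled_submat_def)

text \<open>Keeps minors within the class of labelled submatrices, so that the maximality in
  \<open>is_maxvol\<close> can be applied to cofactors.\<close>

lemma mat_delete_labelled_submat:
  assumes "a < length I" "b < length J"
  shows "mat_delete (labelled_submat M I J) a b =
    labelled_submat M (take a I @ drop (Suc a) I) (take b J @ drop (Suc b) J)"
proof -
  have nth: "(take a xs @ drop (Suc a) xs) ! i = xs ! (if i < a then i else Suc i)"
    if "a < length xs" for xs :: "'z list" and a i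
    using that by (auto simp: nth_append min_def)
  show ?thesis
    using assms by (intro eq_matI) (auto simp: mat_delete_def nth labelled_submat_def)
qed

lemma selection_delete:
  assumes "selection P (Suc r) I" "a < Suc r"
  shows "selection P r (take a I @ drop (Suc a) I)"
proof -
  have "distinct (take a I @ I ! a # drop (Suc a) I)"
    using assms by (simp add: selection_def id_take_nth_drop[symmetric])
  then have "distinct (take a I @ drop (Suc a) I)" by auto
  moreover have "set (take a I @ drop (Suc a) I) \<subseteq> P"
    using assms set_take_subset[of a I] set_drop_subset[of "Suc a" I] by (auto simp: selection_def)
  ultimately show ?thesis using assms by (simp add: selection_def)
qed

section \<open>Linear algebra: products as index sums, the adjugate, kernel vectors\<close>

lemma mat_mult_vec_sum:
  "A \<in> carrier_mat m n \<Longrightarrow> v \<in> carrier_vec n \<Longrightarrow> i < m \<Longrightarrow>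
    (A *\<^sub>v v) $ i = (\<Sum>j<n. A $$ (i, j) * v $ j)"
  by (auto simp: scalar_prod_def Matrix.row_def atLeast0LessThan intro!: sum.cong)

lemma mat_mult_sum:
  "A \<in> carrier_mat m n \<Longrightarrow> B \<in> carrier_mat n p \<Longrightarrow> i < m \<Longrightarrow> k < p \<Longrightarrow>
    (A * B) $$ (i, k) = (\<Sum>j<n. A $$ (i, j) * B $$ (j, k))"
  by (auto simp: scalar_prod_def Matrix.row_def Matrix.col_def atLeast0LessThan intro!: sum.cong)

lemma adj_mat_mult_mat_vec:
  assumes A: "A \<in> carrier_mat n n" and v: "v \<in> carrier_vec n"
  shows "adj_mat A *\<^sub>v (A *\<^sub>v v) = det A \<cdot>\<^sub>v v"
proof -
  have "adj_mat A *\<^sub>v (A *\<^sub>v v) = (det A \<cdot>\<^sub>m 1\<^sub>m n) *\<^sub>v v"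
    using adj_mat[OF A] A v by (simp flip: assoc_mult_mat_vec)
  also have "\<dots> = det A \<cdot>\<^sub>v (1\<^sub>m n *\<^sub>v v)"
    using v by auto
  finally show ?thesis using v by simp
qed

text \<open>The vectors \<open>V k\<close> impose only \<open>r\<close> linear conditions on
  \<open>r + 1\<close> unknowns, and these conditions do not involve \<open>U\<close>.\<close>

lemma low_rank_kernel_vector:
  fixes U :: "nat \<Rightarrow> nat \<Rightarrow> 'a::field"
  shows "\<exists>v\<in>carrier_vec (Suc r). v \<noteq> 0\<^sub>v (Suc r) \<and>
    (\<forall>a. (\<Sum>c<Suc r. (\<Sum>k<r. U a k * V k c) * v $ c) = 0)"
proof -
  \<comment> \<open>Row \<open>r\<close> is a zero row: it makes the system square and forces the
    determinant to vanish.\<close>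
  define W where "W = mat\<^sub>r (Suc r) (Suc r) (\<lambda>k. if k = r then 0\<^sub>v (Suc r) else vec (Suc r) (V k))"
  have W: "W \<in> carrier_mat (Suc r) (Suc r)" by (simp add: W_def)
  have "det W = 0"
    unfolding W_def
    by (rule det_row_0[of r "Suc r" "\<lambda>k. vec (Suc r) (V k)"]) auto
  then obtain v where v: "v \<in> carrier_vec (Suc r)" "v \<noteq> 0\<^sub>v (Suc r)" "W *\<^sub>v v = 0\<^sub>v (Suc r)"
    using det_0_iff_vec_prod_zero[OF W] by auto
  have Vv: "(\<Sum>c<Suc r. V k c * v $ c) = 0" if "k < r" for k
  proof -
    have "(\<Sum>c<Suc r. V k c * v $ c) = (\<Sum>c<Suc r. W $$ (k, c) * v $ c)"
      using that by (intro sum.cong) (auto simp: W_def mat_of_rows_def)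
    also have "\<dots> = (W *\<^sub>v v) $ k"
      using mat_mult_vec_sum[OF W v(1)] that by simp
    also have "\<dots> = 0" using v(3) that by simp
    finally show ?thesis .
  qed
  have "(\<Sum>c<Suc r. (\<Sum>k<r. U a k * V k c) * v $ c) = 0" for a
  proof -
    have "(\<Sum>c<Suc r. (\<Sum>k<r. U a k * V k c) * v $ c) =
        (\<Sum>c<Suc r. \<Sum>k<r. U a k * (V k c * v $ c))"
      by (simp add: sum_distrib_right mult.assoc del: sum.lessThan_Suc)
    also have "\<dots> = (\<Sum>k<r. U a k * (\<Sum>c<Suc r. V k c * v $ c))"
      by (subst sum.swap) (simp add: sum_distrib_left del: sum.lessThan_Suc)
    also have "\<dots> = 0" using Vv by (simp del: sum.lessThan_Suc)
    finally show ?thesis .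
  qed
  with v show ?thesis by blast
qed

text \<open>Nonsingularity enters through an explicit two-sided inverse \<open>B\<close>. The right
  inverse gives exactness on the selected rows, the left inverse on the selected columns.\<close>

locale maxvol_cross =
  fixes M :: "'b \<Rightarrow> 'c \<Rightarrow> 'a::real_normed_field" and P Q r I J B
  assumes maxvol: "is_maxvol M P Q r I J"
    and inverse_carrier: "B \<in> carrier_mat r r"
    and right_inverse: "labelled_submat M I J * B = 1\<^sub>m r"
    and left_inverse: "B * labelled_submat M I J = 1\<^sub>m r"
begin

text \<open>The coordinates by which the cross expresses column \<open>j\<close> through the
  selected columns \<open>J\<close>.\<close>

definition coeff :: "'c \<Rightarrow> nat \<Rightarrow> 'a" where
  "coeff j t = (\<Sum>s<r. B $$ (t, s) * M (I ! s) j)"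

text \<open>The residual of the cross (skeleton) approximation, that is, the Schur complement of the
  selected block in the bordered matrix.\<close>

definition err :: "'b \<Rightarrow> 'c \<Rightarrow> 'a" where
  "err i j = M i j - (\<Sum>t<r. M i (J ! t) * coeff j t)"

lemma sel_rows: "distinct I" "set I \<subseteq> P" "length I = r"
  and sel_cols: "distinct J" "set J \<subseteq> Q" "length J = r"
  using maxvol by (auto simp: is_maxvol_def selection_def)

lemma submat_carrier: "labelled_submat M I J \<in> carrier_mat r r"
  using sel_rows sel_cols by (intro labelled_submat_carrier)

lemma det_nonzero: "det (labelled_submat M I J) \<noteq> 0"
  using det_mult[OF submat_carrier inverse_carrier] right_inverse by auto

lemma coeff_selected: "t < r \<Longrightarrow> u < r \<Longrightarrow> coeff (J ! u) t = (if t = u then 1 else 0)"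
proof -
  assume tu: "t < r" "u < r"
  have "(\<Sum>s<r. B $$ (t, s) * labelled_submat M I J $$ (s, u)) = (if t = u then 1 else 0)"
    using mat_mult_sum[OF inverse_carrier submat_carrier tu] left_inverse tu by simp
  then show ?thesis
    using sel_rows sel_cols tu by (simp add: coeff_def)
qed

lemma submat_mult_coeff: "s < r \<Longrightarrow> (\<Sum>t<r. M (I ! s) (J ! t) * coeff j t) = M (I ! s) j"
proof -
  assume s: "s < r"
  have "(\<Sum>t<r. M (I ! s) (J ! t) * coeff j t) =
      (\<Sum>u<r. (\<Sum>t<r. M (I ! s) (J ! t) * B $$ (t, u)) * M (I ! u) j)"
    unfolding coeff_def sum_distrib_left sum_distrib_right
    by (subst sum.swap) (simp add: mult.assoc)
  also have "\<dots> = (\<Sum>u<r. (if s = u then 1 else 0) * M (I ! u) j)"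
  proof (intro sum.cong refl)
    fix u assume "u \<in> {..<r}"
    then have u: "u < r" by simp
    have "(\<Sum>t<r. labelled_submat M I J $$ (s, t) * B $$ (t, u)) = (if s = u then 1 else 0)"
      using mat_mult_sum[OF submat_carrier inverse_carrier s u] right_inverse s u by simp
    then show "(\<Sum>t<r. M (I ! s) (J ! t) * B $$ (t, u)) * M (I ! u) j =
        (if s = u then 1 else 0) * M (I ! u) j"
      using sel_rows sel_cols s by simp
  qed
  also have "\<dots> = M (I ! s) j" using s by (simp add: if_distrib[of "\<lambda>x. x * _"] cong: if_cong)
  finally show ?thesis .
qed

text \<open>By Cramer's rule, a coefficient is the ratio of two minors.\<close>

lemma norm_coeff_le_1:
  assumes "j \<in> Q" "t < r"
  shows "norm (coeff j t) \<le> 1"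
\<comment> \<open>If \<open>j\<close> already occurs in \<open>J\<close>, then
  \<open>J[t := j]\<close> may repeat a label and would not compete in \<open>is_maxvol\<close>;
  this case is read off directly.\<close>
proof (cases "j \<in> set J")
  case True
  then obtain u where "u < r" "j = J ! u"
    using sel_cols by (auto simp: in_set_conv_nth)
  then show ?thesis using coeff_selected assms by simp
next
  case False
  let ?S = "labelled_submat M I J" and ?x = "vec r (coeff j)"
  have "?S *\<^sub>v ?x = vec r (\<lambda>s. M (I ! s) j)"
    using submat_mult_coeff mat_mult_vec_sum[OF submat_carrier, of ?x] sel_rows sel_cols
    by (intro eq_vecI) simp_all
  then have "replace_col ?S (?S *\<^sub>v ?x) t = labelled_submat M I (J[t := j])"
    using sel_rows sel_cols assms by (intro eq_matI) (auto simp: replace_col_def)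
  then have eq: "det (labelled_submat M I (J[t := j])) = coeff j t * det ?S"
    using cramer_lemma_mat[OF submat_carrier _ assms(2), of ?x] assms by simp
  have "selection Q r (J[t := j])"
    using sel_cols assms False set_update_subset_insert[of J t j]
    by (auto simp: selection_def distinct_list_update)
  then have "norm (coeff j t * det ?S) \<le> norm (det ?S)"
    using maxvol unfolding is_maxvol_def eq[symmetric] by blast
  then show ?thesis
    using det_nonzero by (simp add: norm_mult)
qed

lemma err_selected_row: "i \<in> set I \<Longrightarrow> err i j = 0"
  using submat_mult_coeff sel_rows by (auto simp: err_def in_set_conv_nth)

lemma err_selected_col:
  assumes "j \<in> set J"
  shows "err i j = 0"
proof -
  obtain u where u: "u < r" "j = J ! u"
    using assms sel_cols by (auto simp: in_set_conv_nth)
  have "(\<Sum>t<r. M i (J ! t) * coeff j t) = (\<Sum>t<r. if t = u then M i j else 0)"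
    using u coeff_selected by (intro sum.cong) auto
  then show ?thesis using u by (simp add: err_def)
qed

text \<open>Up to sign, a cofactor is a minor on \<open>r\<close> of the \<open>r + 1\<close> rows
  and columns, hence a competitor for the maximal volume.\<close>

lemma norm_cofactor_bordered_le:
  assumes "selection P (Suc r) I'" "selection Q (Suc r) J'" "a < Suc r" "b < Suc r"
  shows "norm (cofactor (labelled_submat M I' J') a b) \<le> norm (det (labelled_submat M I J))"
proof -
  have "length I' = Suc r" "length J' = Suc r" using assms by (auto simp: selection_def)
  then show ?thesis
    using maxvol assms selection_delete[OF assms(1,3)] selection_delete[OF assms(2,4)]
    by (simp add: cofactor_def norm_mult norm_power mat_delete_labelled_submat is_maxvol_def)
qed

text \<open>
  The vector \<open>(-coeff j, 1)\<close> is mapped by the bordered matrix to \<open>err i j\<close> times the last unit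
  vector; applying the adjugate gives the Schur complement formula.
\<close>

lemma det_bordered:
  "det (labelled_submat M (I @ [i]) (J @ [j])) = det (labelled_submat M I J) * err i j"
proof -
  let ?H = "labelled_submat M (I @ [i]) (J @ [j])"
  define w where "w = vec (Suc r) (\<lambda>t. if t < r then - coeff j t else 1)"
  have H: "?H \<in> carrier_mat (Suc r) (Suc r)"
    using sel_rows sel_cols by (intro labelled_submat_carrier) auto
  have w: "w \<in> carrier_vec (Suc r)" by (simp add: w_def)
  have Hw: "(?H *\<^sub>v w) $ s = (if s = r then err i j else 0)" if "s < Suc r" for s
  proof -
    have "(?H *\<^sub>v w) $ s = (\<Sum>t<Suc r. ?H $$ (s, t) * w $ t)"
      using mat_mult_vec_sum[OF H w that] .
    also have "\<dots> = M ((I @ [i]) ! s) j - (\<Sum>t<r. M ((I @ [i]) ! s) (J ! t) * coeff j t)"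
      using sel_rows sel_cols that by (simp add: w_def nth_append sum_negf)
    also have "\<dots> = (if s = r then err i j else 0)"
      using sel_rows submat_mult_coeff that by (auto simp: err_def nth_append)
    finally show ?thesis .
  qed
  note adj = adj_mat(1)[OF H]
  have "det ?H = (det ?H \<cdot>\<^sub>v w) $ r" by (simp add: w_def)
  also have "det ?H \<cdot>\<^sub>v w = adj_mat ?H *\<^sub>v (?H *\<^sub>v w)"
    using adj_mat_mult_mat_vec[OF H] w by simp
  also have "\<dots> $ r = (\<Sum>s<Suc r. adj_mat ?H $$ (r, s) * (?H *\<^sub>v w) $ s)"
    by (rule mat_mult_vec_sum[OF adj mult_mat_vec_carrier[OF H w]]) simp
  also have "\<dots> = (\<Sum>s<Suc r. if s = r then adj_mat ?H $$ (r, r) * err i j else 0)"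
    using Hw by (intro sum.cong) auto
  also have "\<dots> = cofactor ?H r r * err i j"
    using sel_rows sel_cols by (simp add: adj_mat_def)
  \<comment> \<open>The corner \<open>(r, r)\<close> has an even index sum, so the cofactor carries
    no sign, and the deletion leaves exactly \<open>I\<close> and \<open>J\<close>.\<close>
  also have "cofactor ?H r r = det (labelled_submat M I J)"
    using sel_rows sel_cols by (simp add: cofactor_def mat_delete_labelled_submat)
  finally show ?thesis .
qed

text \<open>Common source of the entrywise and the Frobenius bound. Bounding the cardinalities only
  from above lets the case of zero residual use empty sets.\<close>

lemma norm_err_le_sum:
  assumes "i \<in> P" "j \<in> Q"
    and N: "\<And>x y. x \<in> P \<Longrightarrow> y \<in> Q \<Longrightarrow> N x y = (\<Sum>k<r. U x k * V k y)"
  obtains X Y where "X \<subseteq> P" "Y \<subseteq> Q" "finite X" "finite Y" "card X \<le> Suc r" "card Y \<le> Suc r"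
    "norm (err i j) \<le> (\<Sum>x\<in>X. \<Sum>y\<in>Y. norm (M x y - N x y))"
proof (cases "i \<in> set I \<or> j \<in> set J")
  case True
  then have "err i j = 0" using err_selected_row err_selected_col by blast
  then show thesis using that[of "{}" "{}"] by simp
next
  case False
  let ?n = "Suc r"
  let ?I = "I @ [i]" and ?J = "J @ [j]"
  let ?H = "labelled_submat M ?I ?J" and ?D = "det (labelled_submat M I J)"
  let ?E = "\<lambda>b c. M (?I ! b) (?J ! c) - N (?I ! b) (?J ! c)"
  have I': "selection P ?n ?I" and J': "selection Q ?n ?J"
    using False assms sel_rows sel_cols by (auto simp: selection_def)
  have mem: "?I ! b \<in> P" "?J ! b \<in> Q" if "b < ?n" for b
    using I' J' nth_mem[of b ?I] nth_mem[of b ?J] that unfolding selection_def by (metis subsetD)+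
  have H: "?H \<in> carrier_mat ?n ?n"
    using sel_rows sel_cols by (intro labelled_submat_carrier) auto
  obtain v where v: "v \<in> carrier_vec ?n" "v \<noteq> 0\<^sub>v ?n"
    and ker: "\<And>a. (\<Sum>c<?n. (\<Sum>k<r. U (?I ! a) k * V k (?J ! c)) * v $ c) = 0"
    using low_rank_kernel_vector[of r "\<lambda>a. U (?I ! a)" "\<lambda>k c. V k (?J ! c)"] by auto
  \<comment> \<open>Since \<open>v\<close> is annihilated by the bordered submatrix of
    \<open>N\<close>, entries of \<open>M\<close> may be replaced by entries of the
    difference.\<close>
  have Hv: "(?H *\<^sub>v v) $ b = (\<Sum>c<?n. ?E b c * v $ c)" if b: "b < ?n" for b
  proof -
    have "(\<Sum>c<?n. N (?I ! b) (?J ! c) * v $ c) = 0"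
      using ker[of b] N mem b by (simp del: sum.lessThan_Suc)
    moreover have "(?H *\<^sub>v v) $ b = (\<Sum>c<?n. M (?I ! b) (?J ! c) * v $ c)"
      using mat_mult_vec_sum[OF H v(1) b] b sel_rows sel_cols by (simp del: sum.lessThan_Suc)
    ultimately show ?thesis by (simp add: left_diff_distrib sum_subtractf del: sum.lessThan_Suc)
  qed
  \<comment> \<open>The largest modulus in \<open>v\<close> bounds all components on the right and
    is attained by component \<open>a\<close> on the left, so it cancels in the end.\<close>
  define m where "m = Max ((\<lambda>c. norm (v $ c)) ` {..<?n})"
  have m_ge: "norm (v $ c) \<le> m" if "c < ?n" for c
    unfolding m_def using that by (intro Max_ge) auto
  have "m \<in> (\<lambda>c. norm (v $ c)) ` {..<?n}"
    unfolding m_def by (intro Max_in) auto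
  then obtain a where a: "a < ?n" "norm (v $ a) = m" by auto
  obtain c where "c < ?n" "v $ c \<noteq> 0" using v by (metis carrier_vecD eq_vecI index_zero_vec)
  then have m_pos: "m > 0" using m_ge[of c] by (smt (verit) zero_less_norm_iff)
  note adj = adj_mat(1)[OF H]
  have "det ?H * v $ a = (det ?H \<cdot>\<^sub>v v) $ a" using v(1) a by simp
  also have "det ?H \<cdot>\<^sub>v v = adj_mat ?H *\<^sub>v (?H *\<^sub>v v)"
    using adj_mat_mult_mat_vec[OF H] v by simp
  also have "\<dots> $ a = (\<Sum>b<?n. adj_mat ?H $$ (a, b) * (?H *\<^sub>v v) $ b)"
    by (rule mat_mult_vec_sum[OF adj mult_mat_vec_carrier[OF H v(1)] a(1)])
  also have "\<dots> = (\<Sum>b<?n. cofactor ?H b a * (\<Sum>c<?n. ?E b c * v $ c))"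
    using a Hv sel_rows sel_cols by (intro sum.cong) (auto simp: adj_mat_def simp del: sum.lessThan_Suc)
  finally have "norm (det ?H * v $ a) \<le> (\<Sum>b<?n. norm (cofactor ?H b a * (\<Sum>c<?n. ?E b c * v $ c)))"
    by (simp only: norm_sum)
  also have "\<dots> \<le> (\<Sum>b<?n. norm ?D * (\<Sum>c<?n. norm (?E b c) * m))"
  proof (intro sum_mono)
    fix b assume "b \<in> {..<?n}"
    then have "norm (cofactor ?H b a) \<le> norm ?D"
      using norm_cofactor_bordered_le[OF I' J' _ a(1)] by simp
    moreover have "norm (\<Sum>c<?n. ?E b c * v $ c) \<le> (\<Sum>c<?n. norm (?E b c) * m)"
      using m_ge by (intro sum_norm_le) (auto simp: norm_mult intro!: mult_left_mono)
    ultimately show "norm (cofactor ?H b a * (\<Sum>c<?n. ?E b c * v $ c)) \<le>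
        norm ?D * (\<Sum>c<?n. norm (?E b c) * m)"
      unfolding norm_mult by (intro mult_mono) auto
  qed
  also have "\<dots> = norm ?D * m * (\<Sum>b<?n. \<Sum>c<?n. norm (?E b c))"
    by (simp add: sum_distrib_left sum_distrib_right mult_ac del: sum.lessThan_Suc)
  finally have "norm ?D * m * norm (err i j) \<le> norm ?D * m * (\<Sum>b<?n. \<Sum>c<?n. norm (?E b c))"
    by (simp add: det_bordered norm_mult a(2) mult_ac del: sum.lessThan_Suc)
  then have "norm (err i j) \<le> (\<Sum>b<?n. \<Sum>c<?n. norm (?E b c))"
    using m_pos det_nonzero by (simp del: sum.lessThan_Suc)
  \<comment> \<open>Both label lists are distinct, so sums over positions become sums over label
    sets.\<close>
  also have "\<dots> = (\<Sum>b<?n. \<Sum>y\<in>set ?J. norm (M (?I ! b) y - N (?I ! b) y))"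
    using J' by (intro sum.cong refl sum.reindex_bij_betw bij_betw_nth) (auto simp: selection_def)
  also have "\<dots> = (\<Sum>x\<in>set ?I. \<Sum>y\<in>set ?J. norm (M x y - N x y))"
    using I' by (intro sum.reindex_bij_betw[of "(!) ?I"] bij_betw_nth) (auto simp: selection_def)
  finally have "norm (err i j) \<le> (\<Sum>x\<in>set ?I. \<Sum>y\<in>set ?J. norm (M x y - N x y))" .
  moreover have "card (set ?I) \<le> ?n" "card (set ?J) \<le> ?n"
    using I' J' card_length[of ?I] card_length[of ?J] unfolding selection_def by auto
  ultimately show thesis
    using that[of "set ?I" "set ?J"] I' J' by (simp only: selection_def finite_set simp_thms)
qed

lemma norm_err_le_max:
  assumes "i \<in> P" "j \<in> Q"
    and "\<And>x y. x \<in> P \<Longrightarrow> y \<in> Q \<Longrightarrow> N x y = (\<Sum>k<r. U x k * V k y)"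
    and E: "\<And>x y. x \<in> P \<Longrightarrow> y \<in> Q \<Longrightarrow> norm (M x y - N x y) \<le> E"
  shows "norm (err i j) \<le> (real r + 1)\<^sup>2 * E"
proof -
  obtain X Y where XY: "X \<subseteq> P" "Y \<subseteq> Q" "finite X" "finite Y" "card X \<le> Suc r" "card Y \<le> Suc r"
    "norm (err i j) \<le> (\<Sum>x\<in>X. \<Sum>y\<in>Y. norm (M x y - N x y))"
    using norm_err_le_sum[OF assms(1,2), of N U V] assms(3) by blast
  \<comment> \<open>The sign matters because the cardinalities of \<open>X\<close> and
    \<open>Y\<close> are only bounded from above.\<close>
  have "E \<ge> 0" using E[OF assms(1,2)] norm_ge_zero order_trans by blast
  have "(\<Sum>x\<in>X. \<Sum>y\<in>Y. norm (M x y - N x y)) \<le> (\<Sum>x\<in>X. \<Sum>y\<in>Y. E)"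
    using XY E by (intro sum_mono) auto
  also have "\<dots> = real (card X) * real (card Y) * E" by simp
  also have "\<dots> \<le> (real r + 1) * (real r + 1) * E"
    using XY \<open>E \<ge> 0\<close> by (intro mult_right_mono mult_mono) auto
  finally show ?thesis using XY by (simp add: power2_eq_square)
qed

text \<open>Cauchy-Schwarz against the constant 1, whose L2 norm over at most
  \<open>(r + 1)\<^sup>2\<close> entries is at most \<open>r + 1\<close>. This saves one factor
  \<open>r + 1\<close> over the entrywise estimate.\<close>

lemma norm_err_le_L2:
  assumes "i \<in> P" "j \<in> Q" and "finite P" "finite Q"
    and "\<And>x y. x \<in> P \<Longrightarrow> y \<in> Q \<Longrightarrow> N x y = (\<Sum>k<r. U x k * V k y)"
    and E: "L2_set (\<lambda>(x, y). norm (M x y - N x y)) (P \<times> Q) \<le> E"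
  shows "norm (err i j) \<le> (real r + 1) * E"
proof -
  let ?e = "\<lambda>(x, y). norm (M x y - N x y)"
  obtain X Y where XY: "X \<subseteq> P" "Y \<subseteq> Q" "finite X" "finite Y" "card X \<le> Suc r" "card Y \<le> Suc r"
    "norm (err i j) \<le> (\<Sum>x\<in>X. \<Sum>y\<in>Y. norm (M x y - N x y))"
    using norm_err_le_sum[OF assms(1,2), of N U V] assms(5) by blast
  have "(\<Sum>x\<in>X. \<Sum>y\<in>Y. norm (M x y - N x y)) = (\<Sum>p\<in>X \<times> Y. \<bar>1\<bar> * \<bar>?e p\<bar>)"
    by (simp add: sum.cartesian_product split_def)
  also have "\<dots> \<le> L2_set (\<lambda>_. 1) (X \<times> Y) * L2_set ?e (X \<times> Y)"
    by (rule L2_set_mult_ineq)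
  also have "\<dots> \<le> (real r + 1) * E"
  proof (intro mult_mono)
    have "real (card X) * real (card Y) \<le> (real r + 1) * (real r + 1)"
      using XY by (intro mult_mono) auto
    then show "L2_set (\<lambda>_. 1) (X \<times> Y) \<le> real r + 1"
      by (simp add: L2_set_def card_cartesian_product real_le_lsqrt power2_eq_square)
    have "L2_set ?e (X \<times> Y) \<le> L2_set ?e (P \<times> Q)"
      unfolding L2_set_def using XY assms by (intro real_sqrt_le_mono sum_mono2) auto
    then show "L2_set ?e (X \<times> Y) \<le> E" using E by simp
  qed auto
  finally show ?thesis using XY by simp
qed

end

section \<open>Nested sums as products of a row vector with matrices\<close>

lemma sum_PiE_insert:
  assumes "a \<notin> S"
  shows "(\<Sum>s\<in>Pi\<^sub>E (insert a S) T. f s) = (\<Sum>x\<in>T a. \<Sum>s\<in>Pi\<^sub>E S T. f (s(a := x)))"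
  using inj_combinator[OF assms, of T]
  by (simp add: PiE_insert_eq sum.reindex sum.cartesian_product split_def)

text \<open>The row vector \<open>v\<close> times the matrices \<open>g k\<close>, ...,
  \<open>g (k + m - 1)\<close>, where \<open>g j\<close> has size \<open>r j\<close> by
  \<open>r (j + 1)\<close>. Plain functions keep dimension conditions out of the statements.\<close>

primrec chain :: "(nat \<Rightarrow> nat) \<Rightarrow> (nat \<Rightarrow> nat \<Rightarrow> nat \<Rightarrow> 'a::comm_semiring_1) \<Rightarrow> (nat \<Rightarrow> 'a) \<Rightarrow>
    nat \<Rightarrow> nat \<Rightarrow> nat \<Rightarrow> 'a" where
  "chain r g v k 0 = v"
| "chain r g v k (Suc m) = (\<lambda>x. \<Sum>y<r (k + m). chain r g v k m y * g (k + m) y x)"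

text \<open>Associativity of the product; it cuts a train into a left and a right part.\<close>

lemma chain_add: "chain r g v k (m + n) = chain r g (chain r g v k m) (k + m) n"
  by (induction n) (simp_all add: add.assoc)

lemma chain_cong:
  "(\<And>j y x. k \<le> j \<Longrightarrow> j < k + m \<Longrightarrow> g j y x = h j y x) \<Longrightarrow> chain r g v k m = chain r h v k m"
  by (induction m) simp_all

text \<open>Expansion of \<open>v\<close> in unit vectors. The range condition on \<open>x\<close>
  matters for \<open>m = 0\<close>, where only unit vectors below \<open>r k\<close> are
  available.\<close>

lemma chain_linear:
  "x < r (k + m) \<Longrightarrow>
    chain r g v k m x = (\<Sum>a<r k. v a * chain r g (\<lambda>b. if b = a then 1 else 0) k m x)"
proof (induction m arbitrary: x)
  case 0
  then have "(\<Sum>a<r k. v a * (if x = a then 1 else 0)) = v x"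
    by (simp add: if_distrib[of "\<lambda>y. _ * y"] cong: if_cong)
  then show ?case by simp
next
  case (Suc m)
  let ?e = "\<lambda>a b. if b = a then 1 else 0"
  have "chain r g v k (Suc m) x =
      (\<Sum>y<r (k + m). \<Sum>a<r k. v a * chain r g (?e a) k m y * g (k + m) y x)"
    using Suc.IH by (simp add: sum_distrib_right)
  also have "\<dots> = (\<Sum>a<r k. v a * chain r g (?e a) k (Suc m) x)"
    by (subst sum.swap) (simp add: sum_distrib_left mult.assoc)
  finally show ?case .
qed

text \<open>The update freezes the last index at \<open>x\<close>. It is also applied inside
  \<open>v\<close> because the first and the last index coincide for \<open>m = 0\<close>.\<close>

lemma sum_PiE_fixed_end_eq_chain:
  "(\<Sum>s\<in>(\<Pi>\<^sub>E j\<in>{k..<k + m}. {..<r j}).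
      v ((s(k + m := x)) k) * (\<Prod>j=k..<k + m. g j (s j) ((s(k + m := x)) (Suc j)))) =
    chain r g v k m x"
proof (induction m arbitrary: x)
  case 0
  then show ?case by simp
next
  case (Suc m)
  let ?T = "\<lambda>j. {..<r j}" and ?n = "k + m"
  let ?f = "\<lambda>s x. v ((s(?n := x)) k) * (\<Prod>j=k..<?n. g j (s j) ((s(?n := x)) (Suc j)))"
  have set: "{k..<k + Suc m} = insert ?n {k..<?n}" by auto
  have "(\<Sum>s\<in>Pi\<^sub>E {k..<k + Suc m} ?T.
      v ((s(k + Suc m := x)) k) * (\<Prod>j=k..<k + Suc m. g j (s j) ((s(k + Suc m := x)) (Suc j)))) =
      (\<Sum>y<r ?n. \<Sum>s\<in>Pi\<^sub>E {k..<?n} ?T. ?f s y * g ?n y x)"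
    unfolding set
  proof (subst sum_PiE_insert, simp, intro sum.cong refl)
    fix y s
    have "(\<Prod>j=k..<?n. g j ((s(?n := y)) j) ((s(?n := y, k + Suc m := x)) (Suc j))) =
        (\<Prod>j=k..<?n. g j (s j) ((s(?n := y)) (Suc j)))"
      by (intro prod.cong) auto
    then show "v ((s(?n := y, k + Suc m := x)) k) *
        (\<Prod>j\<in>insert ?n {k..<?n}. g j ((s(?n := y)) j) ((s(?n := y, k + Suc m := x)) (Suc j))) =
        ?f s y * g ?n y x"
      by (simp add: mult_ac)
  qed
  also have "\<dots> = chain r g v k (Suc m) x"
    by (simp only: Suc.IH chain.simps flip: sum_distrib_right)
  finally show ?case .
qed

lemma sum_PiE_eq_sum_chain:
  "(\<Sum>s\<in>(\<Pi>\<^sub>E j\<in>{k..k + m}. {..<r j}). v (s k) * (\<Prod>j=k..<k + m. g j (s j) (s (Suc j)))) =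
    (\<Sum>x<r (k + m). chain r g v k m x)"
proof -
  let ?T = "\<lambda>j. {..<r j}" and ?n = "k + m"
  have set: "{k..k + m} = insert ?n {k..<?n}" by auto
  show ?thesis
    unfolding set
  proof (subst sum_PiE_insert, simp, intro sum.cong refl)
    fix x
    have "(\<Sum>s\<in>Pi\<^sub>E {k..<?n} ?T. v ((s(?n := x)) k) *
          (\<Prod>j=k..<?n. g j ((s(?n := x)) j) ((s(?n := x)) (Suc j)))) =
        (\<Sum>s\<in>Pi\<^sub>E {k..<?n} ?T. v ((s(?n := x)) k) *
          (\<Prod>j=k..<?n. g j (s j) ((s(?n := x)) (Suc j))))"
      by (intro sum.cong refl arg_cong2[where f = "(*)"] prod.cong) auto
    then show "(\<Sum>s\<in>Pi\<^sub>E {k..<?n} ?T. v ((s(?n := x)) k) *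
          (\<Prod>j=k..<?n. g j ((s(?n := x)) j) ((s(?n := x)) (Suc j)))) = chain r g v k m x"
      by (simp only: sum_PiE_fixed_end_eq_chain[where v = v and g = g])
  qed
qed

section \<open>Tensor trains\<close>

lemma finite_multi_indices: "finite (multi_indices ns)"
proof (rule finite_subset)
  show "multi_indices ns \<subseteq> {i. set i \<subseteq> {..<Max (insert 0 (set ns))} \<and> length i = length ns}"
    by (force simp: multi_indices_def list_all2_conv_all_nth in_set_conv_nth Max_gr_iff)
  show "finite {i. set i \<subseteq> {..<Max (insert 0 (set ns))} \<and> length i = length ns}"
    by (rule finite_lists_length_eq) simp
qed

lemma multi_indices_length: "i \<in> multi_indices ns \<Longrightarrow> length i = length ns"
  by (auto simp: multi_indices_def dest: list_all2_lengthD)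

lemma multi_indices_append:
  "p \<in> multi_indices (take k ns) \<Longrightarrow> q \<in> multi_indices (drop k ns) \<Longrightarrow> p @ q \<in> multi_indices ns"
  using list_all2_appendI[of "(<)" p "take k ns" q "drop k ns"] by (simp add: multi_indices_def)

lemma multi_indices_take: "i \<in> multi_indices ns \<Longrightarrow> take k i \<in> multi_indices (take k ns)"
  by (simp add: multi_indices_def)

lemma multi_indices_Cons:
  assumes "k < length ns" "i < ns ! k" "q \<in> multi_indices (drop (Suc k) ns)"
  shows "i # q \<in> multi_indices (drop k ns)"
  using assms by (simp add: multi_indices_def Cons_nth_drop_Suc[symmetric])

lemma multi_indices_nonempty: "\<forall>n\<in>set ns. n \<ge> 1 \<Longrightarrow> multi_indices ns \<noteq> {}"
proof (induction ns)
  case (Cons n ns)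
  then obtain i where "i \<in> multi_indices ns" by auto
  then have "0 # i \<in> multi_indices (n # ns)" using Cons.prems by (simp add: multi_indices_def)
  then show ?case by blast
qed (simp add: multi_indices_def)

text \<open>Cut the train after mode \<open>k\<close>: the left cores produce a row vector on which
  the right cores act linearly, so \<open>r k\<close> terms suffice.\<close>

lemma tensor_train_unfolding_rank:
  assumes "is_tensor_train ns r X" "k \<le> length ns"
  obtains U V where "\<And>p q. p \<in> multi_indices (take k ns) \<Longrightarrow> q \<in> multi_indices (drop k ns) \<Longrightarrow>
    X (p @ q) = (\<Sum>a<r k. U p a * V a q)"
proof -
  let ?d = "length ns"
  obtain G where G: "\<And>i. i \<in> multi_indices ns \<Longrightarrow>
      X i = (\<Sum>s\<in>(\<Pi>\<^sub>E k\<in>{..?d}. {..<r k}). \<Prod>k<?d. G k (s k) (i ! k) (s (Suc k)))"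
    using assms by (auto simp: is_tensor_train_def)
  define U where "U p = chain r (\<lambda>j y x. G j y (p ! j) x) (\<lambda>_. 1) 0 k" for p
  \<comment> \<open>The unit start vectors record the action of the right cores. The shift
    \<open>j - k\<close> appears because \<open>q\<close> starts at mode \<open>k + 1\<close>; the
    outer sum closes the train over its last index.\<close>
  define V where "V a q = (\<Sum>x<r ?d. chain r (\<lambda>j y x. G j y (q ! (j - k)) x)
    (\<lambda>b. if b = a then 1 else 0) k (?d - k) x)" for a q
  show thesis
  proof (rule that)
    fix p q assume p: "p \<in> multi_indices (take k ns)" and q: "q \<in> multi_indices (drop k ns)"
    let ?g = "\<lambda>j y x. G j y ((p @ q) ! j) x"
    have len: "length p = k" using multi_indices_length[OF p] assms by simp
    have "X (p @ q) = (\<Sum>s\<in>(\<Pi>\<^sub>E j\<in>{0..0 + ?d}. {..<r j}).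
        (\<lambda>_. 1) (s 0) * (\<Prod>j=0..<0 + ?d. ?g j (s j) (s (Suc j))))"
      using G[OF multi_indices_append[OF p q]] by (simp add: atLeast0LessThan atLeast0AtMost)
    also have "\<dots> = (\<Sum>x<r ?d. chain r ?g (\<lambda>_. 1) 0 (k + (?d - k)) x)"
      using sum_PiE_eq_sum_chain[where r = r and k = 0 and m = ?d and g = ?g and v = "\<lambda>_. 1"] assms(2)
      by simp
    also have "\<dots> = (\<Sum>x<r ?d. chain r ?g (chain r ?g (\<lambda>_. 1) 0 k) k (?d - k) x)"
      by (subst chain_add) simp
    also have "chain r ?g (\<lambda>_. 1) 0 k = U p"
      unfolding U_def by (rule chain_cong) (simp add: len nth_append)
    also have "chain r ?g (U p) k (?d - k) = chain r (\<lambda>j y x. G j y (q ! (j - k)) x) (U p) k (?d - k)"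
      by (rule chain_cong) (simp add: len nth_append)
    also have "(\<Sum>x<r ?d. \<dots> x) = (\<Sum>x<r ?d. \<Sum>a<r k. U p a *
        chain r (\<lambda>j y x. G j y (q ! (j - k)) x) (\<lambda>b. if b = a then 1 else 0) k (?d - k) x)"
      by (intro sum.cong refl chain_linear) (use assms in simp)
    also have "\<dots> = (\<Sum>a<r k. U p a * V a q)"
      unfolding V_def sum_distrib_left by (rule sum.swap)
    finally show "X (p @ q) = (\<Sum>a<r k. U p a * V a q)" .
  qed
qed

section \<open>The cross interpolation: chain form and accumulated error\<close>

lemma tt_cross_eq_sum_chain:
  assumes "d \<ge> 1"
  shows "tt_cross d r A L R i = (\<Sum>x<r d. chain r
    (\<lambda>k y x. \<Sum>z<r k. the (mat_inverse (interp_mat A L R k)) $$ (y, z) *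
      A (L k ! z @ i ! k # R (Suc k) ! x))
    (\<lambda>x. A (i ! 0 # R 1 ! x)) 1 (d - 1) x)"
proof -
  let ?h = "\<lambda>k t z. the (mat_inverse (interp_mat A L R k)) $$ (t k, z) *
      A (L k ! z @ i ! k # R (Suc k) ! t (Suc k))"
  have "tt_cross d r A L R i = (\<Sum>t\<in>(\<Pi>\<^sub>E k\<in>{1..d}. {..<r k}). A (i ! 0 # R 1 ! t 1) *
      (\<Sum>s\<in>(\<Pi>\<^sub>E k\<in>{1..<d}. {..<r k}). \<Prod>k=1..<d. ?h k t (s k)))"
    unfolding tt_cross_def by (subst sum.swap) (simp add: sum_distrib_left)
  \<comment> \<open>For fixed \<open>t\<close>, each \<open>s k\<close> occurs in one factor only,
    so the sum over \<open>s\<close> factorizes and a chain in \<open>t\<close> remains.\<close>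
  also have "\<dots> = (\<Sum>t\<in>(\<Pi>\<^sub>E k\<in>{1..1 + (d - 1)}. {..<r k}). A (i ! 0 # R 1 ! t 1) *
      (\<Prod>k=1..<1 + (d - 1). \<Sum>z<r k. ?h k t z))"
    using assms by (subst prod_sum_PiE) auto
  also have "\<dots> = (\<Sum>x<r (1 + (d - 1)). chain r
    (\<lambda>k y x. \<Sum>z<r k. the (mat_inverse (interp_mat A L R k)) $$ (y, z) *
      A (L k ! z @ i ! k # R (Suc k) ! x))
    (\<lambda>x. A (i ! 0 # R 1 ! x)) 1 (d - 1) x)"
    by (rule sum_PiE_eq_sum_chain[where v = "\<lambda>x. A (i ! 0 # R 1 ! x)" and
        g = "\<lambda>k y x. \<Sum>z<r k. the (mat_inverse (interp_mat A L R k)) $$ (y, z) *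
          A (L k ! z @ i ! k # R (Suc k) ! x)"])
  finally show ?thesis using assms by simp
qed

text \<open>The determinant is the link: an inverse makes it nonzero, hence the matrix is a unit of
  the matrix ring, which excludes \<open>None\<close>.\<close>

lemma mat_inverse_invertible:
  assumes A: "A \<in> carrier_mat n n" and "invertible_mat A"
  shows "the (mat_inverse A) \<in> carrier_mat n n"
    and "A * the (mat_inverse A) = 1\<^sub>m n" and "the (mat_inverse A) * A = 1\<^sub>m n"
proof -
  obtain B where B: "A * B = 1\<^sub>m (dim_row A)" "B * A = 1\<^sub>m (dim_row B)"
    using assms by (auto simp: invertible_mat_def inverts_mat_def)
  have "dim_col B = n" "dim_row B = n"
    using A arg_cong[OF B(1), of dim_col] arg_cong[OF B(2), of dim_col] by simp_all
  then have "B \<in> carrier_mat n n" by auto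
  from det_mult[OF A this] have "det A * det B = 1" using B(1) A by simp
  then have "det A \<noteq> 0" by auto
  then have "mat_inverse A \<noteq> None"
    using mat_inverse(1)[OF A, of "()"] det_non_zero_imp_unit[OF A, of "()"] by blast
  then show "the (mat_inverse A) \<in> carrier_mat n n"
    "A * the (mat_inverse A) = 1\<^sub>m n" "the (mat_inverse A) * A = 1\<^sub>m n"
    using mat_inverse(2)[OF A] by auto
qed

text \<open>The bound \<open>\<delta>\<close> for a single cross is kept generic, so that one
  recursion serves both norms.\<close>

lemma norm_tt_cross_error_le:
  fixes A :: "nat list \<Rightarrow> 'a::real_normed_field" and L R :: "nat \<Rightarrow> nat list list"
  defines "B \<equiv> \<lambda>k. the (mat_inverse (interp_mat A L R k))"
  assumes ns: "length ns = d" "d \<ge> 1" and last: "R d = [[]]" "r d = 1"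
    and cross: "\<And>k. k \<in> {1..<d} \<Longrightarrow> maxvol_cross (unfolding_entry A)
      (multi_indices (take k ns)) (extended_columns ns R k) (r k) (L k) (R k) (B k)"
    and err_le: "\<And>k p q. k \<in> {1..<d} \<Longrightarrow> p \<in> multi_indices (take k ns) \<Longrightarrow>
      q \<in> extended_columns ns R k \<Longrightarrow>
      norm (maxvol_cross.err (unfolding_entry A) (r k) (L k) (R k) (B k) p q) \<le> \<delta>"
    and rho: "\<And>k. k \<in> {1..<d} \<Longrightarrow> real (r k) \<le> \<rho>" and "\<delta> \<ge> 0" "\<rho> \<ge> 0"
    and i: "i \<in> multi_indices ns"
  shows "norm (A i - tt_cross d r A L R i) \<le> \<delta> * (\<Sum>j<d - 1. \<rho> ^ j)"
proof -
  \<comment> \<open>\<open>F m x\<close> is the train after the first \<open>m\<close> cuts; it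
    approximates \<open>A\<close> at the first \<open>m + 1\<close> entries of \<open>i\<close>
    followed by the label \<open>R (m + 1) ! x\<close>.\<close>
  define F where "F = chain r
    (\<lambda>k y x. \<Sum>z<r k. B k $$ (y, z) * A (L k ! z @ i ! k # R (Suc k) ! x))
    (\<lambda>x. A (i ! 0 # R 1 ! x)) 1"
  have len: "length i = d" using multi_indices_length[OF i] ns by simp
  have partial: "norm (A (take (Suc m) i @ R (Suc m) ! x) - F m x) \<le> \<delta> * (\<Sum>j<m. \<rho> ^ j)"
    if "m < d" "x < r (Suc m)" for m x
    using that
  proof (induction m arbitrary: x)
    case 0
    then show ?case using len by (simp add: F_def take_Suc_conv_app_nth)
  next
    case (Suc m)
    let ?k = "Suc m"
    have k: "?k \<in> {1..<d}" using Suc.prems by simp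
    interpret maxvol_cross "unfolding_entry A" "multi_indices (take ?k ns)"
      "extended_columns ns R ?k" "r ?k" "L ?k" "R ?k" "B ?k"
      by (rule cross[OF k])
    define p where "p = take ?k i"
    define q where "q = i ! ?k # R (Suc ?k) ! x"
    have "length (R (Suc ?k)) = r (Suc ?k)"
    \<comment> \<open>Behind the last cut there is no cross; there \<open>R d = [[]]\<close> has
      length 1, which is \<open>r d\<close>.\<close>
    proof (cases "Suc ?k = d")
      case False
      then have "Suc ?k \<in> {1..<d}" using k by simp
      then show ?thesis using maxvol_cross.sel_cols(3)[OF cross] by blast
    qed (simp add: last)
    moreover have "i ! ?k < ns ! ?k"
      using i k ns by (simp add: multi_indices_def list_all2_conv_all_nth)
    ultimately have q: "q \<in> extended_columns ns R ?k"
      using Suc.prems by (auto simp: q_def extended_columns_def)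
    have p: "p \<in> multi_indices (take ?k ns)"
      using multi_indices_take[OF i] by (simp add: p_def)
    have pq: "take (Suc ?k) i @ R (Suc ?k) ! x = p @ q"
      using len k by (simp add: p_def q_def take_Suc_conv_app_nth)
    \<comment> \<open>The inner sum over \<open>z\<close> is exactly \<open>coeff q\<close>, so a
      train step is the cross formula with the entries in row \<open>p\<close> replaced by their
      approximations.\<close>
    have "F (Suc m) x = (\<Sum>t<r ?k. F m t * coeff q t)"
      by (simp add: F_def coeff_def q_def unfolding_entry_def)
    \<comment> \<open>Inserting the exact entries \<open>A (p @ R ?k ! t)\<close> separates the
      residual of the current cross from the inherited errors.\<close>
    then have "A (p @ q) - F (Suc m) x =
        err p q + (\<Sum>t<r ?k. (A (p @ R ?k ! t) - F m t) * coeff q t)"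
      by (simp add: err_def unfolding_entry_def left_diff_distrib sum_subtractf)
    moreover have "norm (err p q + (\<Sum>t<r ?k. (A (p @ R ?k ! t) - F m t) * coeff q t)) \<le>
        \<delta> + (\<Sum>t<r ?k. \<delta> * (\<Sum>j<m. \<rho> ^ j))"
    proof (intro norm_triangle_le add_mono sum_norm_le)
      show "norm (err p q) \<le> \<delta>" using err_le[OF k p q] .
      fix t assume "t \<in> {..<r ?k}"
      then have "norm (A (p @ R ?k ! t) - F m t) \<le> \<delta> * (\<Sum>j<m. \<rho> ^ j)" "norm (coeff q t) \<le> 1"
        using Suc.IH Suc.prems norm_coeff_le_1[OF q] by (simp_all add: p_def)
      then show "norm ((A (p @ R ?k ! t) - F m t) * coeff q t) \<le> \<delta> * (\<Sum>j<m. \<rho> ^ j)"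
        unfolding norm_mult using mult_mono[of _ _ _ 1] by (smt (verit) norm_ge_zero mult_cancel_left2)
    qed
    moreover have "\<delta> + (\<Sum>t<r ?k. \<delta> * (\<Sum>j<m. \<rho> ^ j)) \<le> \<delta> + \<rho> * (\<delta> * (\<Sum>j<m. \<rho> ^ j))"
      using rho[OF k] \<open>\<delta> \<ge> 0\<close> \<open>\<rho> \<ge> 0\<close> by (simp add: mult_right_mono sum_nonneg)
    moreover have "\<delta> + \<rho> * (\<delta> * (\<Sum>j<m. \<rho> ^ j)) = \<delta> * (\<Sum>j<Suc m. \<rho> ^ j)"
      by (simp add: sum.lessThan_Suc_shift sum_distrib_left algebra_simps del: sum.lessThan_Suc)
    ultimately show ?case unfolding pq by simp
  qed
  \<comment> \<open>Since \<open>r d = 1\<close>, only the index 0 is left, and its label is the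
    empty list.\<close>
  have "tt_cross d r A L R i = F (d - 1) 0"
    using last(2) by (simp add: tt_cross_eq_sum_chain[OF ns(2)] F_def B_def)
  then show ?thesis
    using partial[of "d - 1" 0] ns last len by simp
qed

text \<open>Descending induction from the last mode: labels of cut \<open>k\<close> arise by
  prepending a mode index to labels of cut \<open>k + 1\<close>.\<close>

lemma right_sets_multi_indices:
  assumes "R (length ns) = [[]]"
    and "\<And>k. k \<in> {1..<length ns} \<Longrightarrow> set (R k) \<subseteq> extended_columns ns R k"
    and "1 \<le> k" "k \<le> length ns"
  shows "set (R k) \<subseteq> multi_indices (drop k ns)"
  using assms(4,3)
proof (induction rule: inc_induct)
  case base
  then show ?case using assms by (simp add: multi_indices_def)
next
  case (step k)
  then have "set (R k) \<subseteq> extended_columns ns R k" using assms(2) by simp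
  also have "\<dots> \<subseteq> multi_indices (drop k ns)"
    using step by (auto simp: extended_columns_def intro!: multi_indices_Cons)
  finally show ?case .
qed

text \<open>All left parts have the same length, so concatenation is injective on the pairs and no
  tensor entry is counted twice.\<close>

lemma L2_set_unfolding_le_frobenius_norm:
  assumes "Q \<subseteq> multi_indices (drop k ns)"
  shows "L2_set (\<lambda>(p, q). norm (Y (p @ q))) (multi_indices (take k ns) \<times> Q) \<le> frobenius_norm ns Y"
proof -
  let ?S = "multi_indices (take k ns) \<times> Q" and ?cat = "\<lambda>(p, q). p @ q"
  have inj: "inj_on ?cat ?S"
    by (auto intro!: inj_onI dest!: multi_indices_length)
  have "(\<Sum>z\<in>?S. (case z of (p, q) \<Rightarrow> norm (Y (p @ q)))\<^sup>2) = (\<Sum>i\<in>?cat ` ?S. (norm (Y i))\<^sup>2)"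
    by (subst sum.reindex[OF inj]) (auto intro!: sum.cong)
  also have "\<dots> \<le> (\<Sum>i\<in>multi_indices ns. (norm (Y i))\<^sup>2)"
    using assms multi_indices_append by (intro sum_mono2 finite_multi_indices) auto
  finally show ?thesis
    unfolding L2_set_def frobenius_norm_def by (rule real_sqrt_le_mono)
qed

section \<open>Assembly of the two error bounds\<close>

lemma sum_powers_eq:
  fixes x :: real
  assumes "n \<ge> 1"
  shows "(\<Sum>j<n - 1. x ^ j) = (if x = 1 then real n - 1 else (x ^ (n - 1) - 1) / (x - 1))"
  using assms by (simp add: geometric_sum of_nat_diff)

theorem theorem2:
  fixes A X :: "nat list \<Rightarrow> 'a::real_normed_field"
    and ns :: "nat list" and d :: nat
    and r :: "nat \<Rightarrow> nat" and rmax :: nat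
    and L R :: "nat \<Rightarrow> nat list list"
    and E_C E_F :: real
  assumes "length ns = d" and "d \<ge> 2" and "\<forall>n\<in>set ns. n \<ge> 1"
    and "\<forall>k\<in>{1..<d}. r k \<ge> 1"
    and "is_tensor_train ns r X"
    and "chebyshev_norm ns (\<lambda>i. A i - X i) \<le> E_C"
    and "frobenius_norm ns (\<lambda>i. A i - X i) \<le> E_F"
    and "R d = [[]]"
    and "\<forall>k\<in>{1..<d}. is_maxvol (unfolding_entry A)
           (multi_indices (take k ns)) (extended_columns ns R k) (r k) (L k) (R k)"
    and "\<forall>k\<in>{1..<d}. invertible_mat (interp_mat A L R k)"
    and "rmax = Max (r ` {1..<d})"
  shows "chebyshev_norm ns (\<lambda>i. A i - tt_cross d r A L R i)
           \<le> (if rmax = 1 then real d - 1 else (real rmax ^ (d - 1) - 1) / (real rmax - 1))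
               * (real rmax + 1) * E_F \<and>
         chebyshev_norm ns (\<lambda>i. A i - tt_cross d r A L R i)
           \<le> (if rmax = 1 then real d - 1 else (real rmax ^ (d - 1) - 1) / (real rmax - 1))
               * (real rmax + 1)\<^sup>2 * E_C"
proof -
  let ?B = "\<lambda>k. the (mat_inverse (interp_mat A L R k))"
  let ?P = "\<lambda>k. multi_indices (take k ns)" and ?Q = "extended_columns ns R"
  let ?c = "if rmax = 1 then real d - 1 else (real rmax ^ (d - 1) - 1) / (real rmax - 1)"
  have rd: "r d = 1" using assms(1,5) by (simp add: is_tensor_train_def)
  have r_le: "r k \<le> rmax" if "k \<in> {1..<d}" for k
    using that assms(11) by simp
  have cross: "maxvol_cross (unfolding_entry A) (?P k) (?Q k) (r k) (L k) (R k) (?B k)"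
    if k: "k \<in> {1..<d}" for k
  proof -
    have mv: "is_maxvol (unfolding_entry A) (?P k) (?Q k) (r k) (L k) (R k)"
      using assms(9) k by blast
    then have "interp_mat A L R k \<in> carrier_mat (r k) (r k)"
      unfolding interp_mat_def by (intro labelled_submat_carrier) (simp_all add: is_maxvol_def selection_def)
    from mat_inverse_invertible[OF this] assms(10) k mv show ?thesis
      by unfold_locales (auto simp: interp_mat_def)
  qed
  have Q: "?Q k \<subseteq> multi_indices (drop k ns)" if k: "k \<in> {1..<d}" for k
  proof -
    have "set (R (Suc k)) \<subseteq> multi_indices (drop (Suc k) ns)"
      using maxvol_cross.sel_cols(2)[OF cross] assms(1,8) k by (intro right_sets_multi_indices) auto
    then show ?thesis
      using assms(1) k by (auto simp: extended_columns_def intro!: multi_indices_Cons)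
  qed
  \<comment> \<open>Positive mode sizes make the Chebyshev norm a maximum over a nonempty set and
    provide an entry showing that \<open>E_C\<close> is nonnegative.\<close>
  have ne: "multi_indices ns \<noteq> {}" using multi_indices_nonempty assms(3) by blast
  have entry: "norm (A i - X i) \<le> E_C" if "i \<in> multi_indices ns" for i
    using that assms(6) finite_multi_indices[of ns]
    unfolding chebyshev_norm_def by (meson Max_ge finite_imageI imageI order_trans)
  then have "E_C \<ge> 0" using ne norm_ge_zero order_trans by blast
  have "frobenius_norm ns (\<lambda>i. A i - X i) \<ge> 0"
    by (simp add: frobenius_norm_def sum_nonneg)
  then have "E_F \<ge> 0" using assms(7) by simp
  have err: "norm (maxvol_cross.err (unfolding_entry A) (r k) (L k) (R k) (?B k) p q) \<le> (real rmax + 1) * E_F"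
      "norm (maxvol_cross.err (unfolding_entry A) (r k) (L k) (R k) (?B k) p q) \<le> (real rmax + 1)\<^sup>2 * E_C"
    if k: "k \<in> {1..<d}" and p: "p \<in> ?P k" and q: "q \<in> ?Q k" for k p q
  proof -
    interpret maxvol_cross "unfolding_entry A" "?P k" "?Q k" "r k" "L k" "R k" "?B k"
      by (rule cross[OF k])
    obtain U V where "\<And>p q. p \<in> ?P k \<Longrightarrow> q \<in> multi_indices (drop k ns) \<Longrightarrow>
        X (p @ q) = (\<Sum>a<r k. U p a * V a q)"
      using tensor_train_unfolding_rank[OF assms(5), of k] assms(1) k by auto
    \<comment> \<open>The columns \<open>?Q k\<close> belong to the full unfolding, so the
      factorization of \<open>X\<close> restricts to the matrix on which the cross was
      chosen.\<close>
    then have X: "unfolding_entry X p q = (\<Sum>a<r k. U p a * V a q)"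
      if "p \<in> ?P k" "q \<in> ?Q k" for p q
      using that Q[OF k] by (auto simp: unfolding_entry_def)
    have "finite (?Q k)" using Q[OF k] finite_multi_indices by (rule finite_subset)
    moreover have "L2_set (\<lambda>(p, q). norm (unfolding_entry A p q - unfolding_entry X p q)) (?P k \<times> ?Q k) \<le> E_F"
      using L2_set_unfolding_le_frobenius_norm[OF Q[OF k], of "\<lambda>i. A i - X i"] assms(7)
      by (simp add: unfolding_entry_def)
    ultimately have "norm (err p q) \<le> (real (r k) + 1) * E_F"
      using norm_err_le_L2[OF p q finite_multi_indices, of "unfolding_entry X" U V] X by blast
    also have "\<dots> \<le> (real rmax + 1) * E_F"
      using r_le[OF k] \<open>E_F \<ge> 0\<close> by (intro mult_right_mono) auto
    finally show "norm (err p q) \<le> (real rmax + 1) * E_F" .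
    have "norm (unfolding_entry A x y - unfolding_entry X x y) \<le> E_C"
      if "x \<in> ?P k" "y \<in> ?Q k" for x y
      using that Q[OF k] entry multi_indices_append by (auto simp: unfolding_entry_def)
    then have "norm (err p q) \<le> (real (r k) + 1)\<^sup>2 * E_C"
      using norm_err_le_max[OF p q, of "unfolding_entry X" U V] X by blast
    also have "\<dots> \<le> (real rmax + 1)\<^sup>2 * E_C"
      using r_le[OF k] \<open>E_C \<ge> 0\<close> by (intro mult_right_mono power_mono) auto
    finally show "norm (err p q) \<le> (real rmax + 1)\<^sup>2 * E_C" .
  qed
  \<comment> \<open>To be used twice, with \<open>\<delta>\<close> taken from the Frobenius and from
    the Chebyshev bound in \<open>err\<close>.\<close>
  have total: "chebyshev_norm ns (\<lambda>i. A i - tt_cross d r A L R i) \<le> ?c * \<delta>"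
    if nonneg: "\<delta> \<ge> 0" and bound: "\<And>k p q. k \<in> {1..<d} \<Longrightarrow> p \<in> ?P k \<Longrightarrow> q \<in> ?Q k \<Longrightarrow>
      norm (maxvol_cross.err (unfolding_entry A) (r k) (L k) (R k) (?B k) p q) \<le> \<delta>" for \<delta>
  proof -
    have "norm (A i - tt_cross d r A L R i) \<le> ?c * \<delta>" if "i \<in> multi_indices ns" for i
    proof -
      have "norm (A i - tt_cross d r A L R i) \<le> \<delta> * (\<Sum>j<d - 1. real rmax ^ j)"
        using assms(1,2,8) rd cross nonneg bound r_le that
        by (intro norm_tt_cross_error_le) auto
      also have "(\<Sum>j<d - 1. real rmax ^ j) = ?c"
        using sum_powers_eq[of d "real rmax"] assms(2) by simp
      finally show ?thesis by (simp only: mult.commute)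
    qed
    then show ?thesis
      using ne finite_multi_indices by (simp add: chebyshev_norm_def)
  qed
  show ?thesis
    using total[OF _ err(1)] total[OF _ err(2)] \<open>E_F \<ge> 0\<close> \<open>E_C \<ge> 0\<close>
    by (simp only: mult.assoc) simp
qed

end
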